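(* Let $G=(V,E)$ be a finite graph with boundary $B\neq\emptyset$ and non-empty connected interior. Let $d$ be the maximum degree of $G$ and let $r$ be the inscribed radius of $(G,B)$. Then $$\lambda_1(G,B)\ \geq\ \frac{d-1}{r\,d^{\,r}}.$$
   Context: Graphs are finite, undirected and simple. A graph with boundary is a pair $(G,B)$ where $G=(V,E)$ is a graph and $B\subset V$ is such that, with $\Omega:=V\setminus B$ (the interior), (i) $B$ is exactly the set of vertices outside $\Omega$ having at least one neighbor in $\Omega$, and (ii) no edge of $G$ joins two vertices of $B$. It is assumed throughout that $B$ and $\Omega$ are non-empty and that the subgraph induced on $\Omega$ is connected. The first Dirichlet eigenvalue $\lambda_1(G,B)$ is the smallest $\lambda$ for which there is a nonzero $f:V\to\mathbb{R}$ with $f=0$ on $B$ and $\sum_{y\sim x}(f(x)-f(y))=\lambda f(x)$ for all $x\in\Omega$. Equivalently, $\lambda_1(G,B)=\min \frac{\sum_{\{x,y\}\in E}(f(x)-f(y))^2}{\sum_{x\in\Omega}f(x)^2}$ over nonzero $f:V\to\mathbb{R}$ vanishing on $B$. The inscribed radius of $(G,B)$ is $r=\max_{v\in V}\mathrm{dist}(v,B)$. *)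

theory Defs
  imports
    "HOL-Analysis.Analysis"
    "Graph_Theory.Graph_Theory"
begin

text \<open>
  A finite simple undirected graph is a \<^locale>\<open>pair_graph\<close>: a finite, symmetric, loopfree
  digraph without parallel arcs, each undirected edge being represented by its two arcs.
\<close>

definition interior_verts :: "'a pair_pre_digraph \<Rightarrow> 'a set \<Rightarrow> 'a set" where
  "interior_verts G B = pverts G - B"

locale graph_with_boundary = pair_graph G
  for G :: "'a pair_pre_digraph" +
  fixes B :: "'a set"
  assumes boundary_subset: "B \<subseteq> pverts G"
    and boundary_eq:
      "B = {b \<in> pverts G - interior_verts G B. \<exists>x \<in> interior_verts G B. (b, x) \<in> parcs G}"
    and boundary_independent: "b \<in> B \<Longrightarrow> c \<in> B \<Longrightarrow> (b, c) \<notin> parcs G"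
    and boundary_nonempty: "B \<noteq> {}"
    and interior_nonempty: "interior_verts G B \<noteq> {}"
    and interior_connected:
      "Digraph_Component.connected (with_proj G \<restriction> interior_verts G B)"

text \<open>
  Functions are total on the vertex type; only their values on the vertices matter, so being
  nonzero is required on the vertex set.
\<close>

definition dirichlet_eigenvalue :: "'a pair_pre_digraph \<Rightarrow> 'a set \<Rightarrow> real \<Rightarrow> bool" where
  "dirichlet_eigenvalue G B l \<longleftrightarrow>
     (\<exists>f :: 'a \<Rightarrow> real.
        (\<exists>x \<in> pverts G. f x \<noteq> 0) \<and>
        (\<forall>x \<in> B. f x = 0) \<and>
        (\<forall>x \<in> interior_verts G B. (\<Sum>y | (x, y) \<in> parcs G. f x - f y) = l * f x))"

definition first_dirichlet_eigenvalue :: "'a pair_pre_digraph \<Rightarrow> 'a set \<Rightarrow> real" where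
  "first_dirichlet_eigenvalue G B = (LEAST l. dirichlet_eigenvalue G B l)"

definition max_degree :: "'a pair_pre_digraph \<Rightarrow> nat" where
  "max_degree G = (MAX v \<in> pverts G. out_degree (with_proj G) v)"

text \<open>
  The value is unspecified for vertices in different components; a graph with boundary is
  connected, so this case does not arise there.
\<close>

definition graph_dist :: "'a pair_pre_digraph \<Rightarrow> 'a \<Rightarrow> 'a \<Rightarrow> nat" where
  "graph_dist G u v = (LEAST n. \<exists>p. pre_digraph.awalk (with_proj G) u p v \<and> length p = n)"

definition dist_to_set :: "'a pair_pre_digraph \<Rightarrow> 'a \<Rightarrow> 'a set \<Rightarrow> nat" where
  "dist_to_set G v B = (MIN b \<in> B. graph_dist G v b)"

definition inscribed_radius :: "'a pair_pre_digraph \<Rightarrow> 'a set \<Rightarrow> nat" where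
  "inscribed_radius G B = (MAX v \<in> pverts G. dist_to_set G v B)"

text \<open>
  On connected pairs of vertices, \<^const>\<open>graph_dist\<close> is the library's shortest path distance
  for unit weights.
\<close>

lemma (in pair_wf_digraph) graph_dist_eq_mu:
  assumes "u \<rightarrow>\<^sup>*\<^bsub>with_proj G\<^esub> v"
  shows "ereal (real (graph_dist G u v)) = \<mu> (\<lambda>_. 1) u v"
proof -
  have cost: "awalk_cost (\<lambda>_. 1) p = real (length p)" for p
    by (induction p) auto
  have "\<exists>n p. awalk u p v \<and> length p = n"
    using assms by (auto simp: reachable_awalk)
  from LeastI_ex[OF this] obtain p where p: "awalk u p v" "length p = graph_dist G u v"
    unfolding graph_dist_def by blast
  have least: "graph_dist G u v \<le> length q" if "awalk u q v" for q
    unfolding graph_dist_def using that by (auto intro: Least_le)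
  show ?thesis
  proof (rule antisym)
    show "ereal (real (graph_dist G u v)) \<le> \<mu> (\<lambda>_. 1) u v"
      unfolding \<mu>_def by (rule INF_greatest) (use least in \<open>simp add: cost\<close>)
    show "\<mu> (\<lambda>_. 1) u v \<le> ereal (real (graph_dist G u v))"
      using min_cost_le_walk_cost[OF p(1), of "\<lambda>_. 1"] p(2) by (simp add: cost)
  qed
qed

end

theory Submission
  imports Defs
begin

text \<open>
  The eigenvalue equation makes an eigenvalue the Rayleigh quotient of its eigenfunction
  \<open>f\<close>, and the minimum of the Rayleigh quotient over the unit sphere is an eigenvalue. For the
  lower bound, send every interior vertex to a neighbour \<open>p x\<close> closer to \<open>B\<close> and telescope \<open>f\<close>
  along \<open>x, p x, p (p x), \<dots>\<close>, which reaches \<open>B\<close> after at most \<open>r\<close> steps. By Cauchy--Schwarz,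
  \<open>f(x)\<^sup>2\<close> is at most \<open>r\<close> times the energy of this path. As \<open>p\<close> is at most \<open>d\<close>-to-one over the
  interior, every edge lies on at most \<open>1 + d + \<dots> + d\<^bsup>r-1\<^esup> \<le> d\<^sup>r / (d - 1)\<close> of the paths.
\<close>

section \<open>The Dirichlet form\<close>

definition laplacian :: "'a pair_pre_digraph \<Rightarrow> ('a \<Rightarrow> real) \<Rightarrow> 'a \<Rightarrow> real" where
  "laplacian G f x = (\<Sum>y | (x, y) \<in> parcs G. f x - f y)"

text \<open>Every edge contributes twice, once for each of its arcs.\<close>

definition arc_form :: "'a pair_pre_digraph \<Rightarrow> ('a \<Rightarrow> real) \<Rightarrow> ('a \<Rightarrow> real) \<Rightarrow> real" where
  "arc_form G f h = (\<Sum>(x, y) \<in> parcs G. (f x - f y) * (h x - h y))"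

lemma arc_form_self: "arc_form G f f = (\<Sum>(x, y) \<in> parcs G. (f x - f y)\<^sup>2)"
  by (simp add: arc_form_def power2_eq_square)

text \<open>The expansion needed to perturb a minimiser in a direction \<open>h\<close>.\<close>

lemma arc_form_add_scale:
  "arc_form G (\<lambda>x. f x + t * h x) (\<lambda>x. f x + t * h x)
    = arc_form G f f + 2 * t * arc_form G f h + t\<^sup>2 * arc_form G h h"
  by (simp add: arc_form_def sum_distrib_left flip: sum.distrib)
     (auto intro!: sum.cong simp: power2_eq_square algebra_simps)

context pair_graph
begin

lemma arc_sym: "(x, y) \<in> parcs G \<longleftrightarrow> (y, x) \<in> parcs G"
  using pair_sym_arcs by (auto simp: symmetric_def dest: symD)

lemma finite_neighbours [simp]: "finite {y. (x, y) \<in> parcs G}"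
  by (rule finite_subset[OF _ pair_finite_verts]) (auto dest: in_arcsD2)

lemma sum_arcs_conv_neighbours:
  "(\<Sum>(x, y) \<in> parcs G. F x y) = (\<Sum>x \<in> pverts G. \<Sum>y | (x, y) \<in> parcs G. F x y)"
proof -
  have "parcs G = (SIGMA x:pverts G. {y. (x, y) \<in> parcs G})"
    by (auto dest: in_arcsD1)
  then show ?thesis
    by (subst sum.Sigma) (auto simp: pair_finite_verts)
qed

lemma sum_arcs_swap: "(\<Sum>(x, y) \<in> parcs G. F x y) = (\<Sum>(x, y) \<in> parcs G. F y x)"
  by (rule sum.reindex_bij_witness[of _ prod.swap prod.swap]) (auto simp: arc_sym)

text \<open>Summation by parts: after splitting \<open>h x - h y\<close>, reversing the arcs turns
  the second half of the sum into the first. The factor 2 is the double counting of edges by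
  arcs.\<close>

lemma Green_formula: "arc_form G f h = 2 * (\<Sum>x \<in> pverts G. h x * laplacian G f x)"
proof -
  have "arc_form G f h
      = (\<Sum>(x, y) \<in> parcs G. h x * (f x - f y)) + (\<Sum>(x, y) \<in> parcs G. h y * (f y - f x))"
    unfolding arc_form_def
    by (subst sum.distrib[symmetric]) (auto intro!: sum.cong simp: algebra_simps)
  also have "\<dots> = 2 * (\<Sum>(x, y) \<in> parcs G. h x * (f x - f y))"
    by (subst (2) sum_arcs_swap) simp
  finally show ?thesis
    by (simp add: sum_arcs_conv_neighbours laplacian_def sum_distrib_left)
qed

end

section \<open>The first eigenvalue minimises the Rayleigh quotient\<close>

text \<open>A quadratic that is nonnegative and vanishes at 0 has a minimum there, so its derivative
  at 0 is zero.\<close>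

lemma linear_coeff_zero:
  fixes a b :: real
  assumes "\<And>t. a * t + b * t\<^sup>2 \<ge> 0"
  shows "a = 0"
proof (rule ccontr)
  assume a: "a \<noteq> 0"
  \<comment> \<open>Any positive \<open>c\<close> above \<open>b\<close> works: at
    \<open>t = - a / c\<close> the quadratic equals
    \<open>(a / c)\<^sup>2 * (b - c)\<close>.\<close>
  define c where "c = \<bar>b\<bar> + 1"
  have c: "c > 0" "b < c"
    by (auto simp: c_def)
  have "0 \<le> a * (- a / c) + b * (- a / c)\<^sup>2"
    by (rule assms)
  also have "\<dots> = (a / c)\<^sup>2 * (b - c)"
    using c by (simp add: field_simps power2_eq_square)
  also have "\<dots> < 0"
    using a c by (intro mult_pos_neg) auto
  finally show False
    by simp
qed

context graph_with_boundary
begin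

abbreviation "\<Omega> \<equiv> interior_verts G B"

lemma finite_interior: "finite \<Omega>"
  by (simp add: interior_verts_def)

lemma interior_subset: "\<Omega> \<subseteq> pverts G"
  by (auto simp: interior_verts_def)

lemma sum_verts_eq_sum_interior:
  assumes "\<And>x. x \<in> B \<Longrightarrow> F x = 0"
  shows "sum F (pverts G) = sum F \<Omega>"
  using assms interior_subset
  by (intro sum.mono_neutral_right) (auto simp: interior_verts_def)

lemma dirichlet_eigenvalueE:
  assumes "dirichlet_eigenvalue G B l"
  obtains f where "\<And>x. x \<in> B \<Longrightarrow> f x = 0" "(\<Sum>x \<in> \<Omega>. (f x)\<^sup>2) > 0"
    "arc_form G f f = 2 * l * (\<Sum>x \<in> \<Omega>. (f x)\<^sup>2)"
proof -
  from assms obtain f x where x: "x \<in> pverts G" "f x \<noteq> 0" and B: "\<forall>x \<in> B. f x = 0"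
    and eq: "\<forall>x \<in> \<Omega>. laplacian G f x = l * f x"
    unfolding dirichlet_eigenvalue_def laplacian_def by blast
  have "x \<in> \<Omega>"
    using x B by (auto simp: interior_verts_def)
  then have pos: "(\<Sum>x \<in> \<Omega>. (f x)\<^sup>2) > 0"
    using x finite_interior by (intro sum_pos2[of _ x]) auto
  have "arc_form G f f = 2 * (\<Sum>x \<in> \<Omega>. f x * laplacian G f x)"
    using B by (simp add: Green_formula sum_verts_eq_sum_interior)
  also have "\<dots> = 2 * l * (\<Sum>x \<in> \<Omega>. (f x)\<^sup>2)"
    using eq by (simp add: sum_distrib_left power2_eq_square mult_ac)
  finally show thesis
    using that B pos by blast
qed

text \<open>The vertex type may be infinite, so compactness comes from Tychonoff's theorem: forcing
  zero outside \<open>\<Omega>\<close> puts the sphere into a product of compact sets, where it is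
  cut out by a closed condition on finitely many coordinates.\<close>

lemma compact_dirichlet_sphere:
  "compact {f :: 'a \<Rightarrow> real. (\<forall>x. x \<notin> \<Omega> \<longrightarrow> f x = 0) \<and> (\<Sum>x \<in> \<Omega>. (f x)\<^sup>2) = 1}"
proof -
  define K where "K = (\<Pi>\<^sub>E x\<in>UNIV. if x \<in> \<Omega> then {-1..1::real} else {0})"
  have "compactin (product_topology (\<lambda>_. euclidean) UNIV) K"
    unfolding K_def by (subst compactin_PiE) auto
  then have "compact K"
    by (simp add: euclidean_product_topology)
  moreover have "closed {f :: 'a \<Rightarrow> real. (\<Sum>x \<in> \<Omega>. (f x)\<^sup>2) = 1}"
    by (intro closed_Collect_eq continuous_intros continuous_on_product_coordinates)
  moreover have "{f. (\<forall>x. x \<notin> \<Omega> \<longrightarrow> f x = 0) \<and> (\<Sum>x \<in> \<Omega>. (f x)\<^sup>2) = 1}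
      = K \<inter> {f. (\<Sum>x \<in> \<Omega>. (f x)\<^sup>2) = 1}"
  proof -
    have "\<bar>f x\<bar> \<le> 1" if "(\<Sum>x \<in> \<Omega>. (f x)\<^sup>2) = 1" "x \<in> \<Omega>" for f :: "'a \<Rightarrow> real" and x
      using member_le_sum[of x \<Omega> "\<lambda>x. (f x)\<^sup>2"] that finite_interior
      by (simp add: abs_square_le_1)
    then show ?thesis
      by (auto simp: K_def PiE_iff abs_le_iff minus_le_iff split: if_splits)
  qed
  ultimately show ?thesis
    by (simp add: compact_Int_closed)
qed

text \<open>The energy is continuous and attains its minimum on the compact unit sphere; scaling
  extends the bound to all functions vanishing on \<open>B\<close>. The minimum is written
  \<open>2 * l\<close> because \<open>arc_form\<close> counts every edge twice.\<close>

lemma rayleigh_minimiser: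
  obtains f l where "\<And>x. x \<notin> \<Omega> \<Longrightarrow> f x = 0" "(\<Sum>x \<in> \<Omega>. (f x)\<^sup>2) = 1"
    "arc_form G f f = 2 * l"
    "\<And>h. (\<And>x. x \<in> B \<Longrightarrow> h x = 0) \<Longrightarrow> arc_form G h h \<ge> 2 * l * (\<Sum>x \<in> \<Omega>. (h x)\<^sup>2)"
proof -
  define K where "K = {f :: 'a \<Rightarrow> real. (\<forall>x. x \<notin> \<Omega> \<longrightarrow> f x = 0) \<and> (\<Sum>x \<in> \<Omega>. (f x)\<^sup>2) = 1}"
  obtain z where z: "z \<in> \<Omega>"
    using interior_nonempty by blast
  have "(\<Sum>x \<in> \<Omega>. (indicator {z} x :: real)\<^sup>2) = 1"
    by (subst sum.remove[OF finite_interior z]) (auto intro!: sum.neutral)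
  then have "indicator {z} \<in> K"
    using z by (auto simp: K_def indicator_def)
  moreover have "continuous_on K (\<lambda>f. arc_form G f f)"
    unfolding arc_form_self case_prod_beta
    by (intro continuous_intros continuous_on_subset[OF continuous_on_product_coordinates]) auto
  ultimately obtain f where f: "f \<in> K" and min: "\<And>h. h \<in> K \<Longrightarrow> arc_form G f f \<le> arc_form G h h"
    using continuous_attains_inf[of K "\<lambda>f. arc_form G f f"] compact_dirichlet_sphere
    unfolding K_def by blast
  have "arc_form G h h \<ge> arc_form G f f * (\<Sum>x \<in> \<Omega>. (h x)\<^sup>2)" if B: "\<And>x. x \<in> B \<Longrightarrow> h x = 0" for h
  proof (cases "(\<Sum>x \<in> \<Omega>. (h x)\<^sup>2) = 0")
    case True
    then show ?thesis
      by (auto simp: arc_form_self intro!: sum_nonneg)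
  next
    case False
    define s where "s = (\<Sum>x \<in> \<Omega>. (h x)\<^sup>2)"
    have "s \<ge> 0"
      unfolding s_def by (intro sum_nonneg) simp
    with False have s: "s > 0"
      by (simp add: s_def[symmetric])
    \<comment> \<open>Membership in \<open>K\<close> demands zero also off the vertex set, where
      \<open>h\<close> is arbitrary; on vertices \<open>k\<close> is just the normalised
      \<open>h\<close>, as \<open>h\<close> vanishes on \<open>B\<close>.\<close>
    define k where "k x = (if x \<in> \<Omega> then h x / sqrt s else 0)" for x
    have "(\<Sum>x \<in> \<Omega>. (k x)\<^sup>2) = 1"
      using s by (simp add: k_def power_divide s_def flip: sum_divide_distrib)
    then have "k \<in> K"
      by (simp add: K_def k_def)
    have k: "k x = h x / sqrt s" if "x \<in> pverts G" for x
      using that B by (auto simp: k_def interior_verts_def)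
    have "arc_form G k k = (\<Sum>(x, y) \<in> parcs G. (h x - h y)\<^sup>2 / s)"
      unfolding arc_form_self using s
      by (intro sum.cong) (auto simp: k in_arcsD1 in_arcsD2 power_divide simp flip: diff_divide_distrib)
    also have "\<dots> = arc_form G h h / s"
      by (simp add: arc_form_self sum_divide_distrib case_prod_beta)
    finally show ?thesis
      using min[OF \<open>k \<in> K\<close>] s by (simp add: s_def[symmetric] pos_le_divide_eq)
  qed
  then show thesis
    using f that[of f "arc_form G f f / 2"] unfolding K_def by auto
qed

text \<open>\<open>LEAST\<close> over the reals is meaningful only if a least eigenvalue exists. The
  Rayleigh minimum is one: the first variation at the minimiser is the eigenvalue equation, and
  every eigenvalue is a Rayleigh quotient.\<close>

lemma first_dirichlet_eigenvalue_is_eigenvalue: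
  "dirichlet_eigenvalue G B (first_dirichlet_eigenvalue G B)"
proof -
  obtain f l where f0: "\<And>x. x \<notin> \<Omega> \<Longrightarrow> f x = 0" and f1: "(\<Sum>x \<in> \<Omega>. (f x)\<^sup>2) = 1"
    and fl: "arc_form G f f = 2 * l"
    and min: "\<And>h. (\<And>x. x \<in> B \<Longrightarrow> h x = 0) \<Longrightarrow> arc_form G h h \<ge> 2 * l * (\<Sum>x \<in> \<Omega>. (h x)\<^sup>2)"
    using rayleigh_minimiser by blast
  have f0': "f x = 0" if "x \<in> B" for x
    using that f0 by (simp add: interior_verts_def)
  have "laplacian G f z = l * f z" if z: "z \<in> \<Omega>" for z
  proof -
    \<comment> \<open>Perturbing \<open>f\<close> at \<open>z\<close> alone isolates the eigenvalue
      equation at \<open>z\<close>.\<close>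
    define h where "h = (indicator {z} :: 'a \<Rightarrow> real)"
    have sum_h: "(\<Sum>x \<in> S. h x * F x) = F z" if "finite S" "z \<in> S" for S F
      by (subst sum.remove[OF that]) (auto simp: h_def intro!: sum.neutral)
    have hB: "h x = 0" if "x \<in> B" for x
      using z that by (auto simp: h_def interior_verts_def indicator_def)
    have A: "arc_form G f h = 2 * laplacian G f z"
      unfolding Green_formula using z interior_subset by (subst sum_h) auto
    \<comment> \<open>Minimality applied to \<open>f + t * h\<close>; the terms constant in
      \<open>t\<close> cancel, so the linear coefficient must vanish.\<close>
    have "4 * (laplacian G f z - l * f z) * t + (arc_form G h h - 2 * l) * t\<^sup>2 \<ge> 0" for t
    proof -
      have "(\<Sum>x \<in> \<Omega>. (f x + t * h x)\<^sup>2)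
          = (\<Sum>x \<in> \<Omega>. (f x)\<^sup>2) + 2 * t * (\<Sum>x \<in> \<Omega>. h x * f x) + t\<^sup>2 * (\<Sum>x \<in> \<Omega>. h x * h x)"
        by (simp add: sum_distrib_left power2_eq_square algebra_simps flip: sum.distrib)
      also have "\<dots> = 1 + 2 * t * f z + t\<^sup>2"
        unfolding sum_h[OF finite_interior z] f1 by (simp add: h_def)
      finally have "2 * l * (1 + 2 * t * f z + t\<^sup>2) \<le> 2 * l + 2 * t * (2 * laplacian G f z) + t\<^sup>2 * arc_form G h h"
        using min[of "\<lambda>x. f x + t * h x"] by (simp add: arc_form_add_scale f0' hB fl A)
      then show ?thesis
        by (simp add: algebra_simps)
    qed
    from linear_coeff_zero[OF this] show ?thesis
      by simp
  qed
  moreover have "\<exists>x \<in> pverts G. f x \<noteq> 0"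
    using f1 interior_subset by (metis (mono_tags, lifting) power_zero_numeral subsetD sum.neutral zero_neq_one)
  ultimately have "dirichlet_eigenvalue G B l"
    using f0' unfolding dirichlet_eigenvalue_def laplacian_def by blast
  moreover have "l \<le> m" if "dirichlet_eigenvalue G B m" for m
  proof -
    obtain h where "\<And>x. x \<in> B \<Longrightarrow> h x = 0" "(\<Sum>x \<in> \<Omega>. (h x)\<^sup>2) > 0"
      "arc_form G h h = 2 * m * (\<Sum>x \<in> \<Omega>. (h x)\<^sup>2)"
      using dirichlet_eigenvalueE[OF \<open>dirichlet_eigenvalue G B m\<close>] by blast
    with min[of h] show ?thesis
      by simp
  qed
  ultimately show ?thesis
    unfolding first_dirichlet_eigenvalue_def by (rule LeastI2_order)
qed

section \<open>Paths to the boundary\<close>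

text \<open>Ensures that \<open>graph_dist\<close> to a boundary vertex is the length of an actual
  walk. The walk enters \<open>\<Omega>\<close> if it starts on \<open>B\<close>, crosses
  \<open>\<Omega>\<close> to a neighbour of \<open>b\<close> by connectedness, and steps to
  \<open>b\<close>.\<close>

lemma reachable_boundary:
  assumes v: "v \<in> pverts G" and b: "b \<in> B"
  shows "v \<rightarrow>\<^sup>*\<^bsub>with_proj G\<^esub> b"
proof -
  have into: "\<exists>x \<in> \<Omega>. (c, x) \<in> parcs G" if "c \<in> B" for c
    using that boundary_eq by blast
  have sub: "induced_subgraph (with_proj G \<restriction> \<Omega>) (with_proj G)"
    using interior_subset by (auto intro: induced_induce)
  interpret H: wf_digraph "with_proj G \<restriction> \<Omega>"
    by auto
  have "symmetric (with_proj G \<restriction> \<Omega>)"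
    using pair_sym_arcs sub by (rule induced_graph_imp_symmetric)
  then have strong: "strongly_connected (with_proj G \<restriction> \<Omega>)"
    using interior_connected by (rule H.symmetric_connected_imp_strongly_connected)
  obtain x where x: "x \<in> \<Omega>" "(b, x) \<in> parcs G"
    using into[OF b] by blast
  obtain w where w: "w \<in> \<Omega>" "v \<rightarrow>\<^sup>*\<^bsub>with_proj G\<^esub> w"
    using into[of v] v by (cases "v \<in> B") (auto simp: interior_verts_def)
  note w(2)
  also have "w \<rightarrow>\<^sup>*\<^bsub>with_proj G \<restriction> \<Omega>\<^esub> x"
    using strong w x by auto
  then have "w \<rightarrow>\<^sup>*\<^bsub>with_proj G\<^esub> x"
    using sub by (auto intro: reachable_mono)
  also have "x \<rightarrow>\<^sup>*\<^bsub>with_proj G\<^esub> b"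
    using x arc_sym by (intro reachable_adjI) simp
  finally show ?thesis .
qed

lemma finite_boundary: "finite B"
  using boundary_subset by (rule finite_subset) simp

lemma dist_to_set_le_walk:
  assumes "awalk v q b" "b \<in> B"
  shows "dist_to_set G v B \<le> length q"
proof -
  have "graph_dist G v b \<le> length q"
    unfolding graph_dist_def using assms by (auto intro: Least_le)
  moreover have "dist_to_set G v B \<le> graph_dist G v b"
    unfolding dist_to_set_def using assms finite_boundary by simp
  ultimately show ?thesis
    by simp
qed

lemma shortest_walk_to_boundary:
  assumes "v \<in> pverts G"
  obtains q b where "awalk v q b" "b \<in> B" "length q = dist_to_set G v B"
proof -
  have "dist_to_set G v B \<in> graph_dist G v ` B"
    unfolding dist_to_set_def using finite_boundary boundary_nonempty by (intro Min_in) auto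
  then obtain b where b: "b \<in> B" "dist_to_set G v B = graph_dist G v b"
    by blast
  have "\<exists>q. awalk v q b \<and> length q = graph_dist G v b"
    unfolding graph_dist_def
    by (rule LeastI_ex) (use reachable_boundary[OF assms b(1)] in \<open>auto simp: reachable_awalk\<close>)
  then show thesis
    using that b by metis
qed

text \<open>Take the second vertex of a shortest walk to \<open>B\<close>: the rest of the walk is
  shorter by one arc.\<close>

lemma closer_neighbour:
  assumes "v \<in> \<Omega>"
  shows "\<exists>u. (v, u) \<in> parcs G \<and> dist_to_set G u B < dist_to_set G v B"
proof -
  obtain q b where q: "awalk v q b" "b \<in> B" "length q = dist_to_set G v B"
    using assms interior_subset shortest_walk_to_boundary by blast
  have "v \<noteq> b"
    using assms q(2) by (auto simp: interior_verts_def)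
  then obtain e q' where "q = e # q'"
    using q(1) by (cases q) (auto simp: awalk_Nil_iff)
  with q have e: "e \<in> parcs G" "v = fst e" "awalk (snd e) q' b" "Suc (length q') = dist_to_set G v B"
    by (auto simp: awalk_Cons_iff)
  have "dist_to_set G (snd e) B < dist_to_set G v B"
    using dist_to_set_le_walk[OF e(3) q(2)] e(4) by simp
  with e(1,2) show ?thesis
    by (metis prod.collapse)
qed

text \<open>Fixing the boundary lets a path that has reached \<open>B\<close> rest there, so that
  all paths can be given the same number of steps.\<close>

definition parent :: "'a \<Rightarrow> 'a" where
  "parent v = (if v \<in> \<Omega> then SOME u. (v, u) \<in> parcs G \<and> dist_to_set G u B < dist_to_set G v B else v)"

lemma parent_interior:
  assumes "v \<in> \<Omega>"
  shows "(v, parent v) \<in> parcs G" "dist_to_set G (parent v) B < dist_to_set G v B"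
  using someI_ex[OF closer_neighbour[OF assms]] assms by (simp_all add: parent_def)

lemma parent_boundary: "v \<in> B \<Longrightarrow> parent v = v"
  by (simp add: parent_def interior_verts_def)

lemma parent_in_verts: "v \<in> pverts G \<Longrightarrow> parent v \<in> pverts G"
  using parent_interior(1) by (cases "v \<in> \<Omega>") (auto simp: parent_def dest: in_arcsD2)

lemma dist_to_set_le_radius: "v \<in> pverts G \<Longrightarrow> dist_to_set G v B \<le> inscribed_radius G B"
  unfolding inscribed_radius_def by simp

text \<open>Each step from an interior vertex lowers the distance by at least one, and
  \<open>B\<close> is never left.\<close>

lemma parent_funpow_boundary:
  assumes "v \<in> pverts G" "dist_to_set G v B \<le> n"
  shows "(parent ^^ n) v \<in> B"
  using assms
proof (induction n arbitrary: v)
  \<comment> \<open>Distance 0 forces a boundary vertex, since an interior one has a strictly closer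
    parent.\<close>
  case 0
  then show ?case
    using parent_interior(2)[of v] by (auto simp: interior_verts_def)
next
  case (Suc n)
  show ?case
  proof (cases "v \<in> \<Omega>")
    case True
    then have "(parent ^^ n) (parent v) \<in> B"
      using Suc parent_interior(2)[of v] by (intro Suc.IH) (auto simp: parent_in_verts)
    then show ?thesis
      by (simp add: funpow_swap1)
  next
    case False
    then have v: "v \<in> B"
      using Suc by (simp add: interior_verts_def)
    then have "(parent ^^ m) v = v" for m
      by (induction m) (simp_all add: parent_boundary)
    with v show ?thesis
      by metis
  qed
qed

section \<open>Counting the paths through an edge\<close>

lemma card_neighbours_le_max_degree:
  assumes "x \<in> pverts G"
  shows "card {y. (x, y) \<in> parcs G} \<le> max_degree G"
proof -
  have "out_arcs (with_proj G) x = Pair x ` {y. (x, y) \<in> parcs G}"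
    by (auto simp: out_arcs_def)
  then have "card {y. (x, y) \<in> parcs G} = out_degree (with_proj G) x"
    by (simp add: out_degree_def card_image inj_on_def)
  then show ?thesis
    using assms unfolding max_degree_def by simp
qed

text \<open>A vertex is the parent of at most as many interior vertices as it has neighbours.
  Boundary vertices are their own parents and drop out because \<open>h\<close> is zero
  there.\<close>

lemma sum_parent_le:
  fixes h :: "'a \<Rightarrow> real"
  assumes nonneg: "\<And>x. h x \<ge> (0)" and B: "\<And>x. x \<in> B \<Longrightarrow> h x = 0"
  shows "(\<Sum>x \<in> pverts G. h (parent x)) \<le> max_degree G * (\<Sum>x \<in> pverts G. h x)"
proof -
  have "(\<Sum>x \<in> pverts G. h (parent x)) = (\<Sum>x \<in> \<Omega>. h (parent x))"
    by (rule sum_verts_eq_sum_interior) (simp add: parent_boundary B)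
  also have "\<dots> = (\<Sum>(x, u) \<in> (\<lambda>x. (x, parent x)) ` \<Omega>. h u)"
    by (subst sum.reindex) (auto simp: inj_on_def)
  \<comment> \<open>Enlarging to all arcs replaces the number of children of \<open>u\<close> by its
    degree.\<close>
  also have "\<dots> \<le> (\<Sum>(x, u) \<in> parcs G. h u)"
    by (rule sum_mono2) (auto simp: parent_interior nonneg)
  also have "\<dots> = (\<Sum>(u, x) \<in> parcs G. h u)"
    by (rule sum_arcs_swap)
  also have "\<dots> = (\<Sum>u \<in> pverts G. card {x. (u, x) \<in> parcs G} * h u)"
    by (simp add: sum_arcs_conv_neighbours)
  also have "\<dots> \<le> (\<Sum>u \<in> pverts G. max_degree G * h u)"
    by (intro sum_mono mult_right_mono) (auto simp: card_neighbours_le_max_degree nonneg)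
  finally show ?thesis
    by (simp add: sum_distrib_left)
qed

text \<open>Induction with \<open>h\<close> composed with \<open>parent\<close>, which is again
  nonnegative and zero on \<open>B\<close>.\<close>

lemma sum_parent_funpow_le:
  fixes h :: "'a \<Rightarrow> real"
  assumes "\<And>x. h x \<ge> (0)" "\<And>x. x \<in> B \<Longrightarrow> h x = 0"
  shows "(\<Sum>x \<in> pverts G. h ((parent ^^ i) x)) \<le> max_degree G ^ i * (\<Sum>x \<in> pverts G. h x)"
  using assms
proof (induction i arbitrary: h)
  case (Suc i)
  have "(\<Sum>x \<in> pverts G. h ((parent ^^ Suc i) x))
      \<le> max_degree G ^ i * (\<Sum>x \<in> pverts G. h (parent x))"
    using Suc.IH[of "\<lambda>x. h (parent x)"] Suc.prems by (simp add: parent_boundary)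
  also have "\<dots> \<le> max_degree G ^ i * (max_degree G * (\<Sum>x \<in> pverts G. h x))"
    using Suc.prems by (intro mult_left_mono sum_parent_le) auto
  finally show ?case
    by (simp add: mult_ac)
qed simp

text \<open>
  No edge joins two vertices that are parents of each other, as the parent is strictly closer
  to the boundary; so the arc towards the parent and its reverse are both counted on the right.
\<close>

lemma sum_parent_edges_le:
  "2 * (\<Sum>x \<in> pverts G. (f x - f (parent x))\<^sup>2) \<le> arc_form G f f"
proof -
  define U where "U = (\<lambda>x. (x, parent x)) ` \<Omega>"
  have U: "U \<subseteq> parcs G" "prod.swap ` U \<subseteq> parcs G"
    using arc_sym by (auto simp: U_def parent_interior)
  have "False" if "x \<in> \<Omega>" "parent x \<in> \<Omega>" "parent (parent x) = x" for x
    using parent_interior(2)[of x] parent_interior(2)[of "parent x"] that by simp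
  then have disj: "U \<inter> prod.swap ` U = {}"
    unfolding U_def by fastforce
  have fin: "finite U"
    by (simp add: U_def finite_interior)
  have "(\<Sum>x \<in> pverts G. (f x - f (parent x))\<^sup>2) = (\<Sum>x \<in> \<Omega>. (f x - f (parent x))\<^sup>2)"
    by (rule sum_verts_eq_sum_interior) (simp add: parent_boundary)
  also have "\<dots> = (\<Sum>(x, y) \<in> U. (f x - f y)\<^sup>2)"
    unfolding U_def by (subst sum.reindex) (auto simp: inj_on_def)
  finally have *: "(\<Sum>x \<in> pverts G. (f x - f (parent x))\<^sup>2) = (\<Sum>(x, y) \<in> U. (f x - f y)\<^sup>2)" .
  also have "\<dots> = (\<Sum>(x, y) \<in> prod.swap ` U. (f x - f y)\<^sup>2)"
    by (subst sum.reindex) (auto simp: case_prod_beta power2_commute intro: inj_on_subset[OF inj_swap])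
  finally have "2 * (\<Sum>x \<in> pverts G. (f x - f (parent x))\<^sup>2)
      = (\<Sum>(x, y) \<in> U \<union> prod.swap ` U. (f x - f y)\<^sup>2)"
    using * fin disj by (subst sum.union_disjoint) auto
  also have "\<dots> \<le> arc_form G f f"
    unfolding arc_form_self using U by (intro sum_mono2) auto
  finally show ?thesis .
qed

section \<open>The Poincare inequality and the eigenvalue bound\<close>

lemma square_le_sum_parent_path:
  fixes f :: "'a \<Rightarrow> real"
  assumes x: "x \<in> pverts G" and B: "\<And>x. x \<in> B \<Longrightarrow> f x = 0"
    and r: "r = inscribed_radius G B"
  shows "(f x)\<^sup>2 \<le> r * (\<Sum>i<r. (f ((parent ^^ i) x) - f (parent ((parent ^^ i) x)))\<^sup>2)"
proof -
  have "(parent ^^ r) x \<in> B"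
    using x dist_to_set_le_radius r by (simp add: parent_funpow_boundary)
  \<comment> \<open>The telescoping sum ends at a boundary value, which is 0; steps after the
    arrival in \<open>B\<close> contribute nothing.\<close>
  then have "f x = (\<Sum>i<r. f ((parent ^^ i) x) - f (parent ((parent ^^ i) x)))"
    using sum_lessThan_telescope'[of "\<lambda>i. f ((parent ^^ i) x)" r] B by simp
  then have "(f x)\<^sup>2 = (\<Sum>i<r. f ((parent ^^ i) x) - f (parent ((parent ^^ i) x)))\<^sup>2"
    by (rule arg_cong)
  also have "\<dots> \<le> r * (\<Sum>i<r. (f ((parent ^^ i) x) - f (parent ((parent ^^ i) x)))\<^sup>2)"
    using sum_squared_le_sum_of_squares[of "\<lambda>i. f ((parent ^^ i) x) - f (parent ((parent ^^ i) x))" "{..<r}"]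
    by (simp add: mult.commute)
  finally show ?thesis .
qed

text \<open>Sum the path bound over all starting vertices and exchange the sums: the
  \<open>i\<close>-th steps together cost at most \<open>max_degree G ^ i\<close> times the energy
  of the parent edges.\<close>

lemma poincare_inequality:
  assumes B: "\<And>x. x \<in> B \<Longrightarrow> f x = 0" and r: "r = inscribed_radius G B"
  shows "2 * (\<Sum>x \<in> \<Omega>. (f x)\<^sup>2) \<le> r * (\<Sum>i<r. real (max_degree G) ^ i) * arc_form G f f"
proof -
  define g where "g x = (f x - f (parent x))\<^sup>2" for x
  have "(\<Sum>x \<in> \<Omega>. (f x)\<^sup>2) = (\<Sum>x \<in> pverts G. (f x)\<^sup>2)"
    by (rule sum_verts_eq_sum_interior[symmetric]) (simp add: B)
  also have "\<dots> \<le> (\<Sum>x \<in> pverts G. r * (\<Sum>i<r. g ((parent ^^ i) x)))"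
    unfolding g_def by (intro sum_mono square_le_sum_parent_path B r)
  also have "\<dots> = r * (\<Sum>i<r. \<Sum>x \<in> pverts G. g ((parent ^^ i) x))"
    by (subst sum.swap) (simp add: sum_distrib_left)
  also have "\<dots> \<le> r * (\<Sum>i<r. max_degree G ^ i * (\<Sum>x \<in> pverts G. g x))"
    by (intro mult_left_mono sum_mono sum_parent_funpow_le) (auto simp: g_def parent_boundary)
  also have "\<dots> = r * (\<Sum>i<r. real (max_degree G) ^ i) * (\<Sum>x \<in> pverts G. g x)"
    by (simp add: sum_distrib_right)
  finally have "2 * (\<Sum>x \<in> \<Omega>. (f x)\<^sup>2)
      \<le> r * (\<Sum>i<r. real (max_degree G) ^ i) * (2 * (\<Sum>x \<in> pverts G. g x))"
    by simp
  also have "\<dots> \<le> r * (\<Sum>i<r. real (max_degree G) ^ i) * arc_form G f f"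
    unfolding g_def by (intro mult_left_mono sum_parent_edges_le mult_nonneg_nonneg sum_nonneg) auto
  finally show ?thesis .
qed

lemma radius_pos: "inscribed_radius G B > 0"
proof -
  obtain z where "z \<in> \<Omega>"
    using interior_nonempty by blast
  then show ?thesis
    using parent_interior(2)[of z] dist_to_set_le_radius[of z] interior_subset by auto
qed

lemma max_degree_pos: "max_degree G > 0"
proof -
  obtain z where z: "z \<in> \<Omega>"
    using interior_nonempty by blast
  then have "card {y. (z, y) \<in> parcs G} > 0"
    using parent_interior(1)[of z] by (auto simp: card_gt_0_iff)
  then show ?thesis
    using card_neighbours_le_max_degree[of z] z interior_subset by force
qed

text \<open>For an eigenfunction the energy in the Poincare inequality is a multiple of the norm,
  which cancels and leaves \<open>1 \<le> r * c * l\<close> with the geometric sum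
  \<open>c\<close>.\<close>

lemma dirichlet_eigenvalue_ge:
  assumes l: "dirichlet_eigenvalue G B l"
    and d: "d = max_degree G" and r: "r = inscribed_radius G B"
  shows "(real d - 1) / (real r * real d ^ r) \<le> l"
proof -
  define c where "c = (\<Sum>i<r. real d ^ i)"
  obtain f where B: "\<And>x. x \<in> B \<Longrightarrow> f x = 0" and pos: "(\<Sum>x \<in> \<Omega>. (f x)\<^sup>2) > 0"
    and eq: "arc_form G f f = 2 * l * (\<Sum>x \<in> \<Omega>. (f x)\<^sup>2)"
    using dirichlet_eigenvalueE[OF l] by blast
  have dr: "d > 0" "r > 0"
    using d r max_degree_pos radius_pos by simp_all
  have "1 * (\<Sum>x \<in> \<Omega>. (f x)\<^sup>2) \<le> (r * c * l) * (\<Sum>x \<in> \<Omega>. (f x)\<^sup>2)"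
    using poincare_inequality[of f, OF B r] by (simp add: eq c_def d mult_ac)
  then have rcl: "1 \<le> r * c * l"
    using pos by (simp only: mult_le_cancel_right_pos)
  have "c > 0"
    unfolding c_def using dr by (intro sum_pos) auto
  then have "r * c > 0"
    using dr by simp
  then have "l \<ge> 0"
    using rcl by (smt (verit) mult_nonneg_nonpos)
  \<comment> \<open>Multiplying by \<open>d - 1\<close> instead of dividing by it collapses the
    geometric sum to \<open>d ^ r - 1\<close> even when \<open>d = 1\<close>.\<close>
  have "real d - 1 \<le> (real d - 1) * (r * c * l)"
    using rcl dr by (simp add: mult_left_mono[of 1 "r * c * l" "real d - 1", simplified])
  also have "\<dots> = l * r * (real d ^ r - 1)"
    using power_diff_1_eq[of "real d" r] by (simp add: c_def)
  \<comment> \<open>Dropping the \<open>- 1\<close> relies on \<open>l\<close> being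
    nonnegative.\<close>
  also have "\<dots> \<le> l * r * real d ^ r"
    using \<open>l \<ge> 0\<close> by (intro mult_left_mono) auto
  finally show ?thesis
    using dr by (simp add: divide_le_eq mult_ac)
qed

end

theorem theorem1p2:
  fixes G :: "'a pair_pre_digraph" and B :: "'a set" and d r :: nat
  assumes "graph_with_boundary G B"
    and "d = max_degree G"
    and "r = inscribed_radius G B"
  shows "first_dirichlet_eigenvalue G B \<ge> (real d - 1) / (real r * real d ^ r)"
proof -
  interpret graph_with_boundary G B
    by (fact assms(1))
  show ?thesis
    using first_dirichlet_eigenvalue_is_eigenvalue assms(2,3) by (rule dirichlet_eigenvalue_ge)
qed

end
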